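(* There exist $\mathbb{H}$-regular surfaces in $\mathbb{H}^1$ which are not $\mathbb{H}$-orientable; that is, there exists a $1$-codimensional $C^1$-Euclidean surface $S\subseteq\mathbb{H}^1$ with $C(S)=\varnothing$ (hence an $\mathbb{H}$-regular $1$-codimensional surface, for which $\mathbb{H}$-orientability is defined) that is not $\mathbb{H}$-orientable.
   Context: The Heisenberg group $\mathbb{H}^1$ is $\mathbb{R}^3$ with coordinates $(x,y,t)$ and product $(x,y,t)*(x',y',t')=(x+x',y+y',t+t'+\frac12(xy'-yx'))$. Its standard left invariant vector fields are $X=\partial_x-\frac12y\,\partial_t$, $Y=\partial_y+\frac12x\,\partial_t$, $T=\partial_t$. The horizontal space at $p$ is $\mathfrak{h}_{1,p}=\operatorname{span}\{X_p,Y_p\}$, with inner product $\langle\cdot,\cdot\rangle_H$ making $X,Y$ orthonormal. For $U\subseteq\mathbb{H}^1$ open, $C^1_{\mathbb{H}}(U,\mathbb{R})$ is the space of continuous $f:U\to\mathbb{R}$ whose horizontal gradient $\nabla_{\mathbb{H}}f=(Xf)X+(Yf)Y$ exists and is continuous in $U$. A subset $S\subseteq\mathbb{H}^1$ is an $\mathbb{H}$-regular $1$-codimensional surface if for every $p\in S$ there are an open neighbourhood $U$ of $p$ and $f\in C^1_{\mathbb{H}}(U,\mathbb{R})$ with $S\cap U=\{f=0\}$ and $\nabla_{\mathbb{H}}f\neq0$ on $U$. A $1$-codimensional $C^1$-Euclidean surface $S\subseteq\mathbb{H}^1$ is a subset such that for every $p\in S$ there are an open neighbourhood $U$ of $p$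 and $g\in C^1(U,\mathbb{R})$ (ordinary Euclidean $C^1$) with $S\cap U=\{g=0\}$ and $\nabla g\neq0$ on $U$ ($\nabla$ the Euclidean gradient). Its characteristic set is $C(S)=\{p\in S:T_pS\subseteq\mathfrak{h}_{1,p}\}$. If $C(S)=\varnothing$ then $S$ is an $\mathbb{H}$-regular $1$-codimensional surface. A $1$-codimensional $C^1$-Euclidean surface $S$ with $C(S)=\varnothing$ is $\mathbb{H}$-orientable if there is a continuous nowhere zero horizontal vector field $n_{\mathbb{H}}=n_{\mathbb{H},1}X+n_{\mathbb{H},2}Y$ defined on all of $S$ and $\mathbb{H}$-orthogonal to $S$, meaning $\langle n_{\mathbb{H},p},w\rangle_H=0$ for all $p\in S$ and all horizontal tangent vectors $w\in T_pS\cap\mathfrak{h}_{1,p}$. *)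

theory Defs
  imports "HOL-Analysis.Analysis"
begin

type_synonym heis = "real \<times> real \<times> real"

fun heis_mult :: "heis \<Rightarrow> heis \<Rightarrow> heis" where
  "heis_mult (x, y, t) (x', y', t') = (x + x', y + y', t + t' + (x * y' - y * x') / 2)"

text \<open>Tangent vectors at a point are identified with elements of the ambient vector space,
  in the basis of coordinate derivatives.\<close>

fun heis_X :: "heis \<Rightarrow> heis" where
  "heis_X (x, y, t) = (1, 0, - y / 2)"

fun heis_Y :: "heis \<Rightarrow> heis" where
  "heis_Y (x, y, t) = (0, 1, x / 2)"

lemma heis_X_flow: "p + s *\<^sub>R heis_X p = heis_mult p (s, 0, 0)"
  by (cases p) simp

lemma heis_Y_flow: "p + s *\<^sub>R heis_Y p = heis_mult p (0, s, 0)"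
  by (cases p) simp

definition horizontal_space :: "heis \<Rightarrow> heis set" where
  "horizontal_space p = span {heis_X p, heis_Y p}"

text \<open>The first two components of a horizontal vector are its coefficients with respect to the
  frame given by \<^const>\<open>heis_X\<close> and \<^const>\<open>heis_Y\<close>, so on each horizontal space this is the inner
  product making that frame orthonormal; see the lemma below. It is only meaningful on
  horizontal vectors.\<close>

definition horizontal_inner :: "heis \<Rightarrow> heis \<Rightarrow> real" where
  "horizontal_inner v w = fst v * fst w + fst (snd v) * fst (snd w)"

lemma horizontal_inner_frame:
  "horizontal_inner (a *\<^sub>R heis_X p + b *\<^sub>R heis_Y p) (c *\<^sub>R heis_X p + d *\<^sub>R heis_Y p)
     = a * c + b * d"
  by (cases p) (simp add: horizontal_inner_def)

text \<open>The integral curves of the two fields are straight lines, so the derivative of a function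
  along a field is its directional derivative; no Euclidean differentiability is involved.\<close>

definition X_deriv :: "(heis \<Rightarrow> real) \<Rightarrow> heis \<Rightarrow> real" where
  "X_deriv f p = deriv (\<lambda>s. f (p + s *\<^sub>R heis_X p)) 0"

definition Y_deriv :: "(heis \<Rightarrow> real) \<Rightarrow> heis \<Rightarrow> real" where
  "Y_deriv f p = deriv (\<lambda>s. f (p + s *\<^sub>R heis_Y p)) 0"

definition horizontal_gradient :: "(heis \<Rightarrow> real) \<Rightarrow> heis \<Rightarrow> heis" where
  "horizontal_gradient f p = X_deriv f p *\<^sub>R heis_X p + Y_deriv f p *\<^sub>R heis_Y p"

definition C1_heis_on :: "heis set \<Rightarrow> (heis \<Rightarrow> real) \<Rightarrow> bool" where
  "C1_heis_on U f \<longleftrightarrow>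
     continuous_on U f \<and>
     (\<forall>p\<in>U. (\<lambda>s. f (p + s *\<^sub>R heis_X p)) field_differentiable (at 0) \<and>
            (\<lambda>s. f (p + s *\<^sub>R heis_Y p)) field_differentiable (at 0)) \<and>
     continuous_on U (horizontal_gradient f)"

definition heis_regular_surface :: "heis set \<Rightarrow> bool" where
  "heis_regular_surface S \<longleftrightarrow>
     (\<forall>p\<in>S. \<exists>U f. open U \<and> p \<in> U \<and> C1_heis_on U f \<and>
        S \<inter> U = {q \<in> U. f q = 0} \<and>
        (\<forall>q\<in>U. horizontal_gradient f q \<noteq> 0))"

text \<open>Below, \<open>G\<close> is the Euclidean gradient of \<open>g\<close>.\<close>

definition C1_surface :: "heis set \<Rightarrow> bool" where
  "C1_surface S \<longleftrightarrow>
     (\<forall>p\<in>S. \<exists>U g G. open U \<and> p \<in> U \<and>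
        (\<forall>q\<in>U. GDERIV g q :> G q) \<and> continuous_on U G \<and>
        S \<inter> U = {q \<in> U. g q = 0} \<and>
        (\<forall>q\<in>U. G q \<noteq> 0))"

text \<open>Velocities at \<open>p\<close> of \<open>C\<^sup>1\<close> curves contained in \<open>S\<close>.\<close>

definition tangent_space :: "heis set \<Rightarrow> heis \<Rightarrow> heis set" where
  "tangent_space S p =
     {v. \<exists>\<gamma> e. e > 0 \<and> \<gamma> C1_differentiable_on {-e<..<e} \<and>
           \<gamma> ` {-e<..<e} \<subseteq> S \<and> \<gamma> 0 = p \<and> (\<gamma> has_vector_derivative v) (at (0::real))}"

definition characteristic_set :: "heis set \<Rightarrow> heis set" where
  "characteristic_set S = {p \<in> S. tangent_space S p \<subseteq> horizontal_space p}"

text \<open>This notion is meant for \<open>C\<^sup>1\<close> surfaces with empty characteristic set.\<close>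

definition heis_orientable :: "heis set \<Rightarrow> bool" where
  "heis_orientable S \<longleftrightarrow>
     (\<exists>n1 n2 n. (\<forall>p\<in>S. n p = n1 p *\<^sub>R heis_X p + n2 p *\<^sub>R heis_Y p) \<and>
        continuous_on S n \<and>
        (\<forall>p\<in>S. n p \<noteq> 0) \<and>
        (\<forall>p\<in>S. \<forall>w \<in> tangent_space S p \<inter> horizontal_space p. horizontal_inner (n p) w = 0))"

end

theory Submission
  imports Defs
begin

text \<open>In cylindrical coordinates \<open>(\<rho>, \<psi>, t)\<close> take the Moebius strip
  \<open>(\<rho>\<^sup>2 - 1) sin (\<psi>/2) = t cos (\<psi>/2)\<close> around the circle \<open>\<rho> = 1, t = 0\<close>; the half angles make
  the left and right hand sides well defined only up to a common sign. The contact form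
  \<open>dt - \<rho>\<^sup>2 d\<psi> / 2\<close> takes the constant value \<open>-1/2\<close> on the tangent field \<open>\<partial>/\<partial>\<psi>\<close> of the
  parametrization \<open>mobius_param\<close> below, so there are no characteristic points. Along the circle the horizontal tangent line
  is spanned by a continuous vector that changes sign after one turn. A horizontal field orthogonal
  to it would make the two-dimensional cross product with this vector a continuous nowhere zero
  function with opposite signs at the angles \<open>0\<close> and \<open>2\<pi>\<close>.\<close>

section \<open>Horizontal planes and a common criterion for both kinds of surface\<close>

lemma horizontal_space_iff:
  "(a, b, c) \<in> horizontal_space (x, y, t) \<longleftrightarrow> c = (x * b - y * a) / 2"
proof
  assume "(a, b, c) \<in> horizontal_space (x, y, t)"
  then obtain k l where "(a, b, c) - k *\<^sub>R heis_X (x, y, t) = l *\<^sub>R heis_Y (x, y, t)"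
    unfolding horizontal_space_def span_insert span_singleton by auto
  then have "a = k" "b = l" "c = - (k * y) / 2 + l * x / 2"
    by auto
  then show "c = (x * b - y * a) / 2"
    by (simp add: field_simps)
next
  assume "c = (x * b - y * a) / 2"
  then have "(a, b, c) = a *\<^sub>R heis_X (x, y, t) + b *\<^sub>R heis_Y (x, y, t)"
    by (simp add: field_simps)
  then show "(a, b, c) \<in> horizontal_space (x, y, t)"
    unfolding horizontal_space_def
    by (metis insertI1 insertI2 span_add span_base span_scale)
qed

lemma GDERIV_along_line:
  fixes g :: "heis \<Rightarrow> real"
  assumes "GDERIV g p :> D"
  shows "((\<lambda>s. g (p + s *\<^sub>R v)) has_real_derivative (v \<bullet> D)) (at 0)"
proof -
  have g: "(g has_derivative (\<lambda>h. h \<bullet> D)) (at (p + 0 *\<^sub>R v))"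
    using assms by (simp add: gderiv_def)
  have "((\<lambda>s. p + s *\<^sub>R v) has_derivative (\<lambda>s. s *\<^sub>R v)) (at 0)"
    by (auto intro!: derivative_eq_intros)
  from has_derivative_compose[OF this g] show ?thesis
    unfolding has_field_derivative_def by (rule has_derivative_eq_rhs) auto
qed

text \<open>One equation serves both notions: by the chain rule its derivatives along the frame are
  inner products with \<open>G\<close>, so if one of them is nonzero then so is \<open>G\<close>.
  Asking for this only at \<open>p\<close> suffices by continuity.\<close>

lemma surface_of_local_equations:
  assumes loc: "\<And>p. p \<in> S \<Longrightarrow> \<exists>U g G. open U \<and> p \<in> U \<and>
      (\<forall>q\<in>U. GDERIV g q :> G q) \<and> continuous_on U G \<and> S \<inter> U = {q \<in> U. g q = 0} \<and>
      (heis_X p \<bullet> G p \<noteq> 0 \<or> heis_Y p \<bullet> G p \<noteq> 0)"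
  shows "C1_surface S" and "heis_regular_surface S"
proof -
  have X: "heis_X = (\<lambda>p. (1, 0, - fst (snd p) / 2))" and Y: "heis_Y = (\<lambda>p. (0, 1, fst p / 2))"
    by auto
  have contX: "continuous_on A heis_X" and contY: "continuous_on A heis_Y" for A
    unfolding X Y by (auto intro!: continuous_intros)
  have "\<exists>U g G. open U \<and> p \<in> U \<and> (\<forall>q\<in>U. GDERIV g q :> G q) \<and> continuous_on U G \<and>
      S \<inter> U = {q \<in> U. g q = 0} \<and> (\<forall>q\<in>U. G q \<noteq> 0) \<and>
      C1_heis_on U g \<and> (\<forall>q\<in>U. horizontal_gradient g q \<noteq> 0)" if "p \<in> S" for p
  proof -
    obtain U g G where U: "open U" "p \<in> U" and g: "\<And>q. q \<in> U \<Longrightarrow> GDERIV g q :> G q"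
      and G: "continuous_on U G" and S: "S \<inter> U = {q \<in> U. g q = 0}"
      and p: "heis_X p \<bullet> G p \<noteq> 0 \<or> heis_Y p \<bullet> G p \<noteq> 0"
      using loc[OF \<open>p \<in> S\<close>] by blast
    define N where "N q = (heis_X q \<bullet> G q)\<^sup>2 + (heis_Y q \<bullet> G q)\<^sup>2" for q
    define V where "V = U \<inter> N -` {0<..}"
    \<comment> \<open>\<open>N\<close> is the squared length of the horizontal gradient; positivity
      is an open condition, so \<open>U\<close> can be shrunk to \<open>V\<close>.\<close>
    have "continuous_on U N"
      unfolding N_def by (intro continuous_intros G contX contY)
    then have "open V"
      unfolding V_def using U(1) by (intro continuous_open_preimage) auto
    moreover have "p \<in> V"
      using U p by (auto simp: V_def N_def sum_power2_gt_zero_iff)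
    moreover have VU: "V \<subseteq> U"
      by (auto simp: V_def)
    moreover have "S \<inter> V = {q \<in> V. g q = 0}"
      using S VU by blast
    moreover have GV: "continuous_on V G"
      using G VU by (rule continuous_on_subset)
    moreover have NV: "heis_X q \<bullet> G q \<noteq> 0 \<or> heis_Y q \<bullet> G q \<noteq> 0" if "q \<in> V" for q
      using that by (auto simp: V_def N_def)
    then have "G q \<noteq> 0" if "q \<in> V" for q
      using that by fastforce
    moreover have hg: "horizontal_gradient g q =
        (heis_X q \<bullet> G q) *\<^sub>R heis_X q + (heis_Y q \<bullet> G q) *\<^sub>R heis_Y q" if "q \<in> V" for q
    proof -
      have "deriv (\<lambda>s. g (q + s *\<^sub>R v)) 0 = v \<bullet> G q" for v
        using g that VU by (blast intro: DERIV_imp_deriv GDERIV_along_line)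
      then show ?thesis
        by (simp only: horizontal_gradient_def X_deriv_def Y_deriv_def)
    qed
    \<comment> \<open>The first two components of a horizontal vector are its frame
      coefficients.\<close>
    then have "horizontal_gradient g q \<noteq> 0" if "q \<in> V" for q
      using NV[OF that] that by (cases q) (auto simp: zero_prod_def)
    moreover have "C1_heis_on V g"
      unfolding C1_heis_on_def
    proof (intro conjI ballI)
      show "continuous_on V g"
        using g VU unfolding gderiv_def
        by (blast intro: continuous_at_imp_continuous_on has_derivative_continuous)
      have "continuous_on V (\<lambda>q. (heis_X q \<bullet> G q) *\<^sub>R heis_X q + (heis_Y q \<bullet> G q) *\<^sub>R heis_Y q)"
        by (intro continuous_intros GV contX contY)
      then show "continuous_on V (horizontal_gradient g)"
        by (rule continuous_on_eq) (simp add: hg)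
    qed (use GDERIV_along_line[OF g] VU in \<open>unfold field_differentiable_def, blast+\<close>)
    ultimately show ?thesis
      using g by (intro exI[of _ V] exI[of _ g] exI[of _ G]) blast
  qed
  note equation = this
  show "C1_surface S"
    unfolding C1_surface_def by (intro ballI, drule equation, elim exE conjE, intro exI conjI)
  show "heis_regular_surface S"
    unfolding heis_regular_surface_def
    by (intro ballI, drule equation, elim exE conjE, intro exI conjI)
qed

section \<open>Parametrization of the strip and its tangent vectors\<close>

definition mobius_radius :: "real \<Rightarrow> real \<Rightarrow> real" where
  "mobius_radius l \<psi> = sqrt (1 + 2 * l * cos (\<psi> / 2))"

text \<open>The parameters are the angle \<open>\<psi>\<close> and the factor \<open>l\<close> in
  \<open>(\<rho>\<^sup>2 - 1, t) = 2 l (cos (\<psi>/2), sin (\<psi>/2))\<close>.\<close>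

definition mobius_param :: "real \<Rightarrow> real \<Rightarrow> heis" where
  "mobius_param l \<psi> =
     (mobius_radius l \<psi> * cos \<psi>, mobius_radius l \<psi> * sin \<psi>, 2 * l * sin (\<psi> / 2))"

definition mobius_strip :: "heis set" where
  "mobius_strip = {mobius_param l \<psi> | l \<psi>. 1 + 2 * l * cos (\<psi> / 2) > 0}"

text \<open>The differential at \<open>(l, \<psi>)\<close> applied to the parameter direction
  \<open>(a, b)\<close>; likewise for \<open>mobius_diff\<close>.\<close>

definition mobius_radius_diff :: "real \<Rightarrow> real \<Rightarrow> real \<Rightarrow> real \<Rightarrow> real" where
  "mobius_radius_diff l \<psi> a b =
     (2 * a * cos (\<psi> / 2) - l * b * sin (\<psi> / 2)) / (2 * mobius_radius l \<psi>)"

definition mobius_diff :: "real \<Rightarrow> real \<Rightarrow> real \<Rightarrow> real \<Rightarrow> heis" where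
  "mobius_diff l \<psi> a b =
     (mobius_radius_diff l \<psi> a b * cos \<psi> - mobius_radius l \<psi> * b * sin \<psi>,
      mobius_radius_diff l \<psi> a b * sin \<psi> + mobius_radius l \<psi> * b * cos \<psi>,
      2 * a * sin (\<psi> / 2) + l * b * cos (\<psi> / 2))"

lemma mobius_radius_pos: "1 + 2 * l * cos (\<psi> / 2) > 0 \<Longrightarrow> mobius_radius l \<psi> > 0"
  by (simp add: mobius_radius_def)

lemma mobius_radius_deriv:
  assumes "1 + 2 * (l + a * s) * cos ((\<psi> + b * s) / 2) > 0"
  shows "((\<lambda>s. mobius_radius (l + a * s) (\<psi> + b * s)) has_real_derivative
      mobius_radius_diff (l + a * s) (\<psi> + b * s) a b) (at s)"
proof -
  have "((\<lambda>s. 1 + 2 * (l + a * s) * cos ((\<psi> + b * s) / 2)) has_real_derivative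
      2 * a * cos ((\<psi> + b * s) / 2) - (l + a * s) * b * sin ((\<psi> + b * s) / 2)) (at s)"
    by (auto intro!: derivative_eq_intros simp: algebra_simps)
  from DERIV_chain2[OF DERIV_real_sqrt[OF assms] this] show ?thesis
    unfolding mobius_radius_def mobius_radius_diff_def
    by (rule DERIV_cong) (simp only: inverse_eq_divide divide_divide_eq_left times_divide_eq_left
        mult_1_left mult.commute[of "sqrt _" 2])
qed

lemma mobius_param_deriv:
  assumes "1 + 2 * (l + a * s) * cos ((\<psi> + b * s) / 2) > 0"
  shows "((\<lambda>s. mobius_param (l + a * s) (\<psi> + b * s)) has_vector_derivative
      mobius_diff (l + a * s) (\<psi> + b * s) a b) (at s)"
proof -
  note r = mobius_radius_deriv[OF assms]
  have "((\<lambda>s. mobius_radius (l + a * s) (\<psi> + b * s) * cos (\<psi> + b * s)) has_real_derivative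
      mobius_radius_diff (l + a * s) (\<psi> + b * s) a b * cos (\<psi> + b * s)
      - mobius_radius (l + a * s) (\<psi> + b * s) * b * sin (\<psi> + b * s)) (at s)"
    by (rule derivative_eq_intros r refl | simp)+
  moreover have "((\<lambda>s. mobius_radius (l + a * s) (\<psi> + b * s) * sin (\<psi> + b * s)) has_real_derivative
      mobius_radius_diff (l + a * s) (\<psi> + b * s) a b * sin (\<psi> + b * s)
      + mobius_radius (l + a * s) (\<psi> + b * s) * b * cos (\<psi> + b * s)) (at s)"
    by (rule derivative_eq_intros r refl | simp)+
  moreover have "((\<lambda>s. 2 * (l + a * s) * sin ((\<psi> + b * s) / 2)) has_real_derivative
      2 * a * sin ((\<psi> + b * s) / 2) + (l + a * s) * b * cos ((\<psi> + b * s) / 2)) (at s)"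
    by (auto intro!: derivative_eq_intros simp: algebra_simps)
  ultimately show ?thesis
    unfolding mobius_param_def mobius_diff_def has_real_derivative_iff_has_vector_derivative
    by (intro has_vector_derivative_Pair)
qed

text \<open>The curve is the image of a straight line in the parameter plane, which stays in the
  open parameter domain for a short time.\<close>

lemma mobius_tangent:
  assumes "1 + 2 * l * cos (\<psi> / 2) > 0"
  shows "mobius_diff l \<psi> a b \<in> tangent_space mobius_strip (mobius_param l \<psi>)"
proof -
  define R where "R s = 1 + 2 * (l + a * s) * cos ((\<psi> + b * s) / 2)" for s
  have "open {s. 0 < R s}"
    unfolding R_def by (intro open_Collect_less continuous_intros) auto
  moreover have "0 \<in> {s. 0 < R s}"
    using assms by (simp add: R_def)
  ultimately obtain e where "e > 0" and e: "ball 0 e \<subseteq> {s. 0 < R s}"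
    by (rule openE)
  have pos: "0 < 1 + 2 * (l + a * s) * cos ((\<psi> + b * s) / 2)" if "s \<in> {-e<..<e}" for s
    using e that by (auto simp: ball_eq_greaterThanLessThan R_def)
  let ?\<gamma> = "\<lambda>s. mobius_param (l + a * s) (\<psi> + b * s)"
  have "?\<gamma> C1_differentiable_on {-e<..<e}"
    unfolding C1_differentiable_on_def
  proof (intro exI conjI ballI)
    show "(?\<gamma> has_vector_derivative mobius_diff (l + a * s) (\<psi> + b * s) a b) (at s)"
      if "s \<in> {-e<..<e}" for s
      using mobius_param_deriv pos that by blast
    show "continuous_on {-e<..<e} (\<lambda>s. mobius_diff (l + a * s) (\<psi> + b * s) a b)"
      unfolding mobius_diff_def mobius_radius_diff_def mobius_radius_def
      using pos by (intro continuous_intros) force+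
  qed
  moreover have "?\<gamma> ` {-e<..<e} \<subseteq> mobius_strip"
    unfolding mobius_strip_def using pos by blast
  moreover have "(?\<gamma> has_vector_derivative mobius_diff l \<psi> a b) (at 0)"
    using mobius_param_deriv[of l a 0 \<psi> b] assms by simp
  ultimately show ?thesis
    unfolding tangent_space_def using \<open>e > 0\<close> by (auto intro!: exI[of _ ?\<gamma>] exI[of _ e])
qed

lemma mobius_radius_sq:
  "1 + 2 * l * cos (\<psi> / 2) > 0 \<Longrightarrow> (mobius_radius l \<psi>)\<^sup>2 = 1 + 2 * l * cos (\<psi> / 2)"
  by (simp add: mobius_radius_def)

text \<open>With \<open>x = \<rho> cos \<psi>\<close> and \<open>y = \<rho> sin \<psi>\<close>,
  these turn \<open>\<rho> + x\<close>, \<open>\<rho> - x\<close> and \<open>y\<close> into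
  \<open>2 \<rho>\<close> times a quadratic monomial in the half angle functions.\<close>

lemma half_angle:
  fixes \<psi> :: real
  shows "1 + cos \<psi> = 2 * (cos (\<psi> / 2))\<^sup>2" "1 - cos \<psi> = 2 * (sin (\<psi> / 2))\<^sup>2"
    "sin \<psi> = 2 * sin (\<psi> / 2) * cos (\<psi> / 2)"
  using cos_double_cos[of "\<psi> / 2"] cos_double_sin[of "\<psi> / 2"] sin_double[of "\<psi> / 2"]
    by (simp_all add: sin_squared_eq)

section \<open>Absence of characteristic points\<close>

lemma characteristic_set_mobius_strip: "characteristic_set mobius_strip = {}"
proof -
  have "\<not> tangent_space mobius_strip p \<subseteq> horizontal_space p" if "p \<in> mobius_strip" for p
  proof -
    obtain l \<psi> where p: "p = mobius_param l \<psi>" and pos: "1 + 2 * l * cos (\<psi> / 2) > 0"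
      using \<open>p \<in> mobius_strip\<close> unfolding mobius_strip_def by blast
    define r where "r = mobius_radius l \<psi>"
    have r: "r > 0" "r\<^sup>2 = 1 + 2 * l * cos (\<psi> / 2)"
      using mobius_radius_pos mobius_radius_sq pos by (auto simp: r_def)
    show ?thesis
    proof
      assume hor: "tangent_space mobius_strip p \<subseteq> horizontal_space p"
      \<comment> \<open>This is the vanishing of the contact form: the radial part of the velocity
        cancels in \<open>x dy - y dx\<close>, leaving \<open>r\<^sup>2 d\<psi>\<close>.\<close>
      have eq: "2 * a * sin (\<psi> / 2) + l * b * cos (\<psi> / 2) = r\<^sup>2 * b / 2" for a b
      proof -
        let ?k = "mobius_radius_diff l \<psi> a b"
        have "mobius_diff l \<psi> a b \<in> horizontal_space (mobius_param l \<psi>)"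
          using hor mobius_tangent[OF pos] p by blast
        then have "2 * a * sin (\<psi> / 2) + l * b * cos (\<psi> / 2) =
            (r * cos \<psi> * (?k * sin \<psi> + r * b * cos \<psi>) - r * sin \<psi> * (?k * cos \<psi> - r * b * sin \<psi>)) / 2"
          by (simp add: mobius_diff_def mobius_param_def horizontal_space_iff r_def)
        also have "\<dots> = r\<^sup>2 * b * ((sin \<psi>)\<^sup>2 + (cos \<psi>)\<^sup>2) / 2"
          by (rule arg_cong[of _ _ "\<lambda>z. z / 2"]) algebra
        finally show ?thesis by simp
      qed
      \<comment> \<open>In the direction of \<open>\<psi>\<close> the right side exceeds the left by
        exactly \<open>1/2\<close>.\<close>
      show False
        using eq[of 0 1] r by simp
    qed
  qed
  then show ?thesis
    by (auto simp: characteristic_set_def)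
qed


section \<open>Implicit equations of the strip\<close>

lemma mobius_strip_iff:
  fixes x y t :: real
  defines "\<rho> \<equiv> sqrt (x\<^sup>2 + y\<^sup>2)"
  shows "(x, y, t) \<in> mobius_strip \<longleftrightarrow>
    \<rho> \<noteq> 0 \<and> (\<rho>\<^sup>2 - 1) * y - t * (\<rho> + x) = 0 \<and> (\<rho>\<^sup>2 - 1) * (\<rho> - x) - t * y = 0"
    (is "_ \<longleftrightarrow> ?R")
proof
  assume "(x, y, t) \<in> mobius_strip"
  then obtain l \<psi> where p: "(x, y, t) = mobius_param l \<psi>" and pos: "1 + 2 * l * cos (\<psi> / 2) > 0"
    unfolding mobius_strip_def by blast
  define A B r where "A = cos (\<psi> / 2)" and "B = sin (\<psi> / 2)" and "r = mobius_radius l \<psi>"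
  have r: "r > 0" "r\<^sup>2 - 1 = 2 * l * A"
    using mobius_radius_pos mobius_radius_sq pos by (auto simp: r_def A_def)
  have xy: "x = r * cos \<psi>" "y = r * sin \<psi>" "t = 2 * l * B"
    using p by (auto simp: mobius_param_def r_def B_def)
  have "x\<^sup>2 + y\<^sup>2 = r\<^sup>2 * ((sin \<psi>)\<^sup>2 + (cos \<psi>)\<^sup>2)"
    unfolding xy power_mult_distrib by (simp add: distrib_left del: sin_cos_squared_add)
  then have "\<rho> = r"
    using r(1) by (simp add: \<rho>_def)
  moreover have "r + x = r * (1 + cos \<psi>)" "r - x = r * (1 - cos \<psi>)"
    by (simp_all add: xy algebra_simps)
  then have "r + x = 2 * r * A\<^sup>2" "r - x = 2 * r * B\<^sup>2" "y = 2 * r * A * B"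
    unfolding xy(2) half_angle[of \<psi>] A_def B_def by simp_all
  ultimately show ?R
    using r xy(3) by (simp add: power2_eq_square)
next
  assume R: ?R
  \<comment> \<open>On the axis both equations hold trivially, so it has to be excluded
    separately.\<close>
  have \<rho>: "\<rho> > 0" "\<rho>\<^sup>2 = x\<^sup>2 + y\<^sup>2"
    using R by (auto simp: \<rho>_def less_le)
  have "(x / \<rho>)\<^sup>2 + (y / \<rho>)\<^sup>2 = 1"
    using \<rho>(1) unfolding power_divide add_divide_distrib[symmetric] \<rho>(2)[symmetric] by simp
  then obtain \<psi> where "x / \<rho> = cos \<psi>" "y / \<rho> = sin \<psi>"
    using sincos_total_2pi by metis
  then have xy: "x = \<rho> * cos \<psi>" "y = \<rho> * sin \<psi>"
    using \<rho> by (auto simp: field_simps)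
  define A B u where "A = cos (\<psi> / 2)" and "B = sin (\<psi> / 2)" and "u = \<rho>\<^sup>2 - 1"
  have AB: "A\<^sup>2 + B\<^sup>2 = 1"
    by (simp add: A_def B_def)
  have "\<rho> + x = \<rho> * (1 + cos \<psi>)" "\<rho> - x = \<rho> * (1 - cos \<psi>)"
    using xy(1) by (simp_all add: algebra_simps)
  then have "\<rho> + x = 2 * \<rho> * A\<^sup>2" "\<rho> - x = 2 * \<rho> * B\<^sup>2" "y = 2 * \<rho> * A * B"
    using xy(2) unfolding half_angle[of \<psi>] A_def B_def by simp_all
  then have "u * (2 * \<rho> * A * B) - t * (2 * \<rho> * A\<^sup>2) = 0"
    "u * (2 * \<rho> * B\<^sup>2) - t * (2 * \<rho> * A * B) = 0"
    using R unfolding u_def by metis+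
  \<comment> \<open>Both equations are multiples of the half angle equation, and \<open>A\<close>,
    \<open>B\<close> do not vanish together.\<close>
  then have "2 * \<rho> * (A * (u * B - t * A)) = 0" "2 * \<rho> * (B * (u * B - t * A)) = 0"
    by (simp_all add: algebra_simps power2_eq_square)
  then have uB: "u * B = t * A"
    using \<rho>(1) AB by auto
  \<comment> \<open>Since \<open>(u, t)\<close> is parallel to the unit vector
    \<open>(A, B)\<close>, it equals its projection \<open>2 * l\<close> times that vector.\<close>
  define l where "l = (u * A + t * B) / 2"
  have "2 * l * A = u * (A\<^sup>2 + B\<^sup>2) + B * (t * A - u * B)"
    "2 * l * B = t * (A\<^sup>2 + B\<^sup>2) + A * (u * B - t * A)"
    by (simp_all add: l_def algebra_simps power2_eq_square)
  then have l: "1 + 2 * l * cos (\<psi> / 2) = \<rho>\<^sup>2" "2 * l * sin (\<psi> / 2) = t"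
    using AB uB by (simp_all add: u_def A_def B_def)
  then have "mobius_radius l \<psi> = \<rho>"
    using \<rho>(1) by (simp add: mobius_radius_def)
  then have "(x, y, t) = mobius_param l \<psi>"
    using xy l by (simp add: mobius_param_def)
  moreover have "1 + 2 * l * cos (\<psi> / 2) > 0"
    using l(1) \<rho>(1) by simp
  ultimately show "(x, y, t) \<in> mobius_strip"
    unfolding mobius_strip_def by blast
qed

section \<open>Two charts with local equations\<close>

definition cyl_radius :: "heis \<Rightarrow> real" where
  "cyl_radius p = sqrt ((fst p)\<^sup>2 + (fst (snd p))\<^sup>2)"

lemma cyl_radius_deriv:
  assumes "cyl_radius p \<noteq> 0"
  shows "(cyl_radius has_derivative
    (\<lambda>h. (fst p * fst h + fst (snd p) * fst (snd h)) / cyl_radius p)) (at p)"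
proof -
  have "(fst p)\<^sup>2 + (fst (snd p))\<^sup>2 > 0"
    using assms by (simp add: cyl_radius_def less_le)
  then show ?thesis
    unfolding cyl_radius_def
    by (auto intro!: derivative_eq_intros simp: fun_eq_iff divide_simps)
qed

lemma continuous_on_cyl_radius [continuous_intros]: "continuous_on A cyl_radius"
  unfolding cyl_radius_def by (intro continuous_intros)

lemma surface_mobius_strip: "C1_surface mobius_strip" "heis_regular_surface mobius_strip"
proof -
  let ?x = "\<lambda>q::heis. fst q" and ?y = "\<lambda>q::heis. fst (snd q)" and ?t = "\<lambda>q::heis. snd (snd q)"
  define r where "r = cyl_radius"
  have r_sq: "(r q)\<^sup>2 = (?x q)\<^sup>2 + (?y q)\<^sup>2" for q
    by (simp add: r_def cyl_radius_def)
  \<comment> \<open>The local equations are the half angle equation multiplied by \<open>2 \<rho> cos (\<psi>/2)\<close> and by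
    \<open>2 \<rho> sin (\<psi>/2)\<close>, which makes them single valued.\<close>
  define g1 where "g1 q = ((r q)\<^sup>2 - 1) * ?y q - ?t q * (r q + ?x q)" for q
  define g2 where "g2 q = ((r q)\<^sup>2 - 1) * (r q - ?x q) - ?t q * ?y q" for q
  have strip: "q \<in> mobius_strip \<longleftrightarrow> r q \<noteq> 0 \<and> g1 q = 0 \<and> g2 q = 0" for q
    using mobius_strip_iff[of "?x q" "?y q" "?t q"] by (simp add: r_def g1_def g2_def cyl_radius_def)
  define G1 where "G1 q = (2 * ?x q * ?y q - ?t q * (?x q / r q + 1),
      2 * (?y q)\<^sup>2 + (r q)\<^sup>2 - 1 - ?t q * ?y q / r q, - (r q + ?x q))" for q
  define G2 where "G2 q = (2 * ?x q * (r q - ?x q) + ((r q)\<^sup>2 - 1) * (?x q / r q - 1),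
      2 * ?y q * (r q - ?x q) + ((r q)\<^sup>2 - 1) * ?y q / r q - ?t q, - ?y q)" for q
  \<comment> \<open>Complements of the closed half planes \<open>y = 0, x \<le> 0\<close> and
    \<open>y = 0, x \<ge> 0\<close>: there \<open>cos (\<psi>/2)\<close>, respectively
    \<open>sin (\<psi>/2)\<close>, is nonzero.\<close>
  define U1 where "U1 = {q. 0 < r q + ?x q}"
  define U2 where "U2 = {q. 0 < r q - ?x q}"
  have cont_r: "continuous_on A r" for A
    unfolding r_def by (rule continuous_on_cyl_radius)
  have U: "open U1" "open U2"
    unfolding U1_def U2_def by (auto intro!: open_Collect_less continuous_intros cont_r)
  have r_ge: "\<bar>?x q\<bar> \<le> r q" for q
    by (simp add: r_def cyl_radius_def)
  have U_nz: "r q \<noteq> 0" if "q \<in> U1 \<union> U2" for q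
    using that r_ge[of q] by (auto simp: U1_def U2_def)
  have d1: "GDERIV g1 q :> G1 q" if "r q \<noteq> 0" for q
    unfolding gderiv_def g1_def G1_def using that cyl_radius_deriv[of q] unfolding r_def
    by (auto intro!: derivative_eq_intros simp: fun_eq_iff inner_prod_def field_simps power2_eq_square)
  have d2: "GDERIV g2 q :> G2 q" if "r q \<noteq> 0" for q
    unfolding gderiv_def g2_def G2_def using that cyl_radius_deriv[of q] unfolding r_def
    by (auto intro!: derivative_eq_intros simp: fun_eq_iff inner_prod_def field_simps power2_eq_square)
  have c1: "continuous_on U1 G1"
    unfolding G1_def using U_nz by (intro continuous_intros cont_r) auto
  have c2: "continuous_on U2 G2"
    unfolding G2_def using U_nz by (intro continuous_intros cont_r) auto
  \<comment> \<open>The two equations differ by the factor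
    \<open>tan (\<psi>/2) = y / (r + x)\<close>, so on each chart its own equation implies the
    other.\<close>
  have rel: "g2 q * (r q + ?x q) = ?y q * g1 q" "g1 q * (r q - ?x q) = ?y q * g2 q" for q
  proof -
    have "(r q - ?x q) * (r q + ?x q) = ?y q * ?y q"
      using r_sq[of q] by (simp add: algebra_simps power2_eq_square)
    then show "g2 q * (r q + ?x q) = ?y q * g1 q" "g1 q * (r q - ?x q) = ?y q * g2 q"
      unfolding g1_def g2_def by algebra+
  qed
  have S1: "mobius_strip \<inter> U1 = {q \<in> U1. g1 q = 0}"
  proof -
    have "g2 q = 0" if "q \<in> U1" "g1 q = 0" for q
      using rel(1)[of q] that by (simp add: U1_def)
    then show ?thesis
      using U_nz strip by blast
  qed
  have S2: "mobius_strip \<inter> U2 = {q \<in> U2. g2 q = 0}"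
  proof -
    have "g1 q = 0" if "q \<in> U2" "g2 q = 0" for q
      using rel(2)[of q] that by (simp add: U2_def)
    then show ?thesis
      using U_nz strip by blast
  qed
  have hx: "heis_X q = (1, 0, - ?y q / 2)" and hy: "heis_Y q = (0, 1, ?x q / 2)" for q
    by (cases q; simp)+
  have rr: "?x q * (?x q / r q) + ?y q * (?y q / r q) = r q" if "r q \<noteq> 0" for q
    using that r_sq[of q] by (simp add: field_simps power2_eq_square)
  \<comment> \<open>The vertical parts of \<open>x X + y Y\<close> cancel, so it is the Euler field
    in \<open>(x, y)\<close>. As \<open>y\<close> and \<open>r + x\<close> are homogeneous of degree
    1, \<open>g1\<close> is reproduced, and \<open>r\<^sup>2\<close> contributes the extra
    term.\<close>
  have radial1: "?x q * (heis_X q \<bullet> G1 q) + ?y q * (heis_Y q \<bullet> G1 q) = 2 * (r q)\<^sup>2 * ?y q + g1 q"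
    if "r q \<noteq> 0" for q
  proof -
    have "?x q * (heis_X q \<bullet> G1 q) + ?y q * (heis_Y q \<bullet> G1 q) =
        2 * ((?x q)\<^sup>2 + (?y q)\<^sup>2) * ?y q + ((r q)\<^sup>2 - 1) * ?y q
        - ?t q * ((?x q * (?x q / r q) + ?y q * (?y q / r q)) + ?x q)"
      by (simp add: hx hy G1_def inner_prod_def algebra_simps power2_eq_square)
    then show ?thesis
      unfolding rr[OF that] r_sq[symmetric] by (simp add: g1_def)
  qed
  have radial2: "?x q * (heis_X q \<bullet> G2 q) + ?y q * (heis_Y q \<bullet> G2 q) =
      2 * (r q)\<^sup>2 * (r q - ?x q) + g2 q" if "r q \<noteq> 0" for q
  proof -
    have "?x q * (heis_X q \<bullet> G2 q) + ?y q * (heis_Y q \<bullet> G2 q) =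
        2 * ((?x q)\<^sup>2 + (?y q)\<^sup>2) * (r q - ?x q)
        + ((r q)\<^sup>2 - 1) * ((?x q * (?x q / r q) + ?y q * (?y q / r q)) - ?x q) - ?t q * ?y q"
      by (simp add: hx hy G2_def inner_prod_def algebra_simps power2_eq_square diff_divide_distrib)
    then show ?thesis
      unfolding rr[OF that] r_sq[symmetric] by (simp add: g2_def)
  qed
  \<comment> \<open>The radial derivative fails only at \<open>y = 0\<close>. On this chart that
    forces \<open>x = r\<close> and \<open>t = 0\<close>, where the derivative along
    \<open>Y\<close> is \<open>r\<^sup>2 - 1 - r\<^sup>2 = -1\<close>.\<close>
  have nz1: "heis_X p \<bullet> G1 p \<noteq> 0 \<or> heis_Y p \<bullet> G1 p \<noteq> 0" if "p \<in> mobius_strip" "p \<in> U1" for p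
  proof (rule ccontr)
    assume "\<not> ?thesis"
    then have X0: "heis_X p \<bullet> G1 p = 0" and Y0: "heis_Y p \<bullet> G1 p = 0" by auto
    have p: "r p \<noteq> 0" "g1 p = 0"
      using that strip by auto
    then have y: "?y p = 0"
      using radial1[of p] X0 Y0 by simp
    then have x: "?x p = r p"
      using \<open>p \<in> U1\<close> by (auto simp: U1_def r_def cyl_radius_def abs_if split: if_splits)
    have "?t p = 0"
      using p x y by (simp add: g1_def)
    then show False
      using Y0 x y by (simp add: hy G1_def inner_prod_def power2_eq_square)
  qed
  \<comment> \<open>Here the radial derivative is \<open>2 r\<^sup>2 (r - x) > 0\<close>, with no
    exceptional points.\<close>
  have nz2: "heis_X p \<bullet> G2 p \<noteq> 0 \<or> heis_Y p \<bullet> G2 p \<noteq> 0" if "p \<in> mobius_strip" "p \<in> U2" for p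
    using radial2[of p] that strip[of p] by (auto simp: U2_def)
  have "\<exists>U g G. open U \<and> p \<in> U \<and> (\<forall>q\<in>U. GDERIV g q :> G q) \<and> continuous_on U G \<and>
      mobius_strip \<inter> U = {q \<in> U. g q = 0} \<and> (heis_X p \<bullet> G p \<noteq> 0 \<or> heis_Y p \<bullet> G p \<noteq> 0)"
    if "p \<in> mobius_strip" for p
  proof (cases "p \<in> U1")
    case True
    then show ?thesis
      using U(1) d1 c1 S1 nz1 U_nz that
      by (intro exI[of _ U1] exI[of _ g1] exI[of _ G1] conjI) blast+
  next
    case False
    then have "p \<in> U2"
      using r_ge[of p] strip that by (auto simp: U1_def U2_def)
    then show ?thesis
      using U(2) d2 c2 S2 nz2 U_nz that
      by (intro exI[of _ U2] exI[of _ g2] exI[of _ G2] conjI) blast+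
  qed
  note loc = this
  show "C1_surface mobius_strip"
    by (rule surface_of_local_equations(1)[OF loc])
  show "heis_regular_surface mobius_strip"
    by (rule surface_of_local_equations(2)[OF loc])
qed

section \<open>Sign change along the central circle\<close>

lemma not_orientable_mobius_strip: "\<not> heis_orientable mobius_strip"
proof
  assume "heis_orientable mobius_strip"
  then obtain n1 n2 n where n: "\<And>p. p \<in> mobius_strip \<Longrightarrow> n p = n1 p *\<^sub>R heis_X p + n2 p *\<^sub>R heis_Y p"
    and cont: "continuous_on mobius_strip n" and nz: "\<And>p. p \<in> mobius_strip \<Longrightarrow> n p \<noteq> 0"
    and orth: "\<And>p w. p \<in> mobius_strip \<Longrightarrow> w \<in> tangent_space mobius_strip p \<Longrightarrow>
      w \<in> horizontal_space p \<Longrightarrow> horizontal_inner (n p) w = 0"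
    unfolding heis_orientable_def by blast
  let ?c = "mobius_param 0"
  have c: "?c \<phi> = (cos \<phi>, sin \<phi>, 0)" for \<phi>
    by (simp add: mobius_param_def mobius_radius_def)
  have c_in: "?c \<phi> \<in> mobius_strip" for \<phi>
    unfolding mobius_strip_def by force
  \<comment> \<open>The coefficient \<open>4 sin (\<phi>/2)\<close> of the angular direction cancels the contact form.\<close>
  define w where "w \<phi> = mobius_diff 0 \<phi> 1 (4 * sin (\<phi> / 2))" for \<phi>
  \<comment> \<open>Radial component \<open>cos (\<phi>/2)\<close> and angular component
    \<open>4 sin (\<phi>/2)\<close>, written in Cartesian coordinates.\<close>
  define w1 where "w1 \<phi> = cos (\<phi> / 2) * cos \<phi> - 4 * sin (\<phi> / 2) * sin \<phi>" for \<phi> :: real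
  define w2 where "w2 \<phi> = cos (\<phi> / 2) * sin \<phi> + 4 * sin (\<phi> / 2) * cos \<phi>" for \<phi> :: real
  have w: "w \<phi> = (w1 \<phi>, w2 \<phi>, 2 * sin (\<phi> / 2))" for \<phi>
    by (simp add: w_def w1_def w2_def mobius_diff_def mobius_radius_diff_def mobius_radius_def)
  have w_tangent: "w \<phi> \<in> tangent_space mobius_strip (?c \<phi>)" for \<phi>
    unfolding w_def by (rule mobius_tangent) simp
  have "cos \<phi> * w2 \<phi> - sin \<phi> * w1 \<phi> = 4 * sin (\<phi> / 2) * ((sin \<phi>)\<^sup>2 + (cos \<phi>)\<^sup>2)" for \<phi>
    unfolding w1_def w2_def by algebra
  then have w_hor: "w \<phi> \<in> horizontal_space (?c \<phi>)" for \<phi>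
    by (simp add: w c horizontal_space_iff)
  define h where "h \<phi> = fst (snd (n (?c \<phi>))) * w1 \<phi> - fst (n (?c \<phi>)) * w2 \<phi>" for \<phi>
  have "continuous_on {0..2 * pi} (\<lambda>\<phi>. n (?c \<phi>))"
    by (rule continuous_on_compose2[OF cont]) (use c_in in \<open>auto simp: c intro!: continuous_intros\<close>)
  then have h_cont: "continuous_on {0..2 * pi} h"
    unfolding h_def w1_def w2_def by (intro continuous_intros) auto
  have h_nz: "h \<phi> \<noteq> 0" for \<phi>
  proof
    assume h0: "h \<phi> = 0"
    define a b where "a = fst (n (?c \<phi>))" and "b = fst (snd (n (?c \<phi>)))"
    have "a * w1 \<phi> + b * w2 \<phi> = 0"
      using orth[OF c_in w_tangent w_hor] by (simp add: horizontal_inner_def w a_def b_def)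
    moreover have "b * w1 \<phi> - a * w2 \<phi> = 0"
      using h0 by (simp add: h_def a_def b_def)
    \<comment> \<open>Lagrange's identity: the squares of the inner and cross products add up to the
      product of the squared lengths.\<close>
    ultimately have "(a\<^sup>2 + b\<^sup>2) * ((w1 \<phi>)\<^sup>2 + (w2 \<phi>)\<^sup>2) = 0"
      by algebra
    moreover have "(w1 \<phi>)\<^sup>2 + (w2 \<phi>)\<^sup>2 = 1 + 15 * (sin (\<phi> / 2))\<^sup>2"
    proof -
      have "(w1 \<phi>)\<^sup>2 + (w2 \<phi>)\<^sup>2 = ((cos (\<phi> / 2))\<^sup>2 + 16 * (sin (\<phi> / 2))\<^sup>2) * ((sin \<phi>)\<^sup>2 + (cos \<phi>)\<^sup>2)"
        unfolding w1_def w2_def by algebra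
      then show ?thesis
        by (simp add: cos_squared_eq)
    qed
    ultimately have "a\<^sup>2 + b\<^sup>2 = 0"
      by (smt (verit) mult_eq_0_iff zero_le_power2)
    then have "a = 0" "b = 0"
      by (auto simp: sum_power2_eq_zero_iff)
    then have "n (?c \<phi>) = 0"
      using n[OF c_in[of \<phi>]] by (simp add: a_def b_def c zero_prod_def)
    then show False
      using nz c_in by blast
  qed
  \<comment> \<open>The base point, hence \<open>n\<close>, returns to its value, while the half
    angles negate \<open>w1\<close> and \<open>w2\<close>.\<close>
  have "h (2 * pi) = - h 0"
    by (simp add: h_def w1_def w2_def c)
  then have "\<exists>\<phi>\<ge>0. \<phi> \<le> 2 * pi \<and> h \<phi> = 0"
    using IVT'[of h 0 0 "2 * pi"] IVT2'[of h "2 * pi" 0 0] h_cont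
    by (cases "h 0 \<le> 0") auto
  then show False
    using h_nz by blast
qed

theorem corollary2p21:
  "\<exists>S :: heis set. C1_surface S \<and> characteristic_set S = {} \<and>
     heis_regular_surface S \<and> \<not> heis_orientable S"
  by (intro exI[of _ mobius_strip] conjI surface_mobius_strip characteristic_set_mobius_strip
      not_orientable_mobius_strip)

end
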